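(* Let $p$ be an odd prime with $p \equiv 1 \pmod 4$, let $m \geq 1$ be an integer, and let $t \in \mathbb{Z}_p$. Then $$ N_{2m}(t, p) = \begin{cases} p^{2m-1} + p^m - p^{m-1} & \text{if } t = 0, \\ p^{2m-1} - p^{m-1} & \text{if } t \neq 0. \end{cases} $$
   Context: $\mathbb{Z}_p$ denotes the ring of integers modulo $p$. For $t \in \mathbb{Z}_p$, $N_j(t,p)$ is the number of ordered $j$-tuples $(x_1,\dots,x_j) \in \mathbb{Z}_p^j$ with $\sum_{i=1}^j x_i^2 = t$ in $\mathbb{Z}_p$ (zero entries are allowed). *)

theory Defs
  imports "HOL-Number_Theory.Residues" "HOL-Library.FuncSet"
begin

(* The ring of integers modulo p is the library's residue_ring (int p), with carrier {0..int p - 1};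
   it is a ring only for p > 1.  Tuples are extensional functions on the index set {1..j},
   so that distinct elements of the set below are distinct tuples. *)

definition sum_squares_count :: "nat \<Rightarrow> int \<Rightarrow> nat \<Rightarrow> nat" where
  "sum_squares_count j t p =
     card {x \<in> {1..j} \<rightarrow>\<^sub>E carrier (residue_ring (int p)).
       (\<Oplus>\<^bsub>residue_ring (int p)\<^esub>i\<in>{1..j}. x i [^]\<^bsub>residue_ring (int p)\<^esub> (2::nat)) = t}"

end

theory Submission
  imports Defs "HOL-Number_Theory.Euler_Criterion"
begin

text \<open>
  The argument works in any finite field with \<open>q\<close> elements in which \<open>2 \<noteq> 0\<close> and \<open>-1\<close> is a
  square, say \<open>-1 = w\<^sup>2\<close>. There the sum of two squares splits as
  \<open>a\<^sup>2 + b\<^sup>2 = (a + wb)(a - wb)\<close>, and \<open>(a, b) \<mapsto> (a + wb, a - wb)\<close> is a bijection, so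
  that over pairs of field elements the form \<open>a\<^sup>2 + b\<^sup>2\<close> may be replaced by the product \<open>uv\<close>.

  Write \<open>N\<^sub>n(t)\<close> for the number of solutions of \<open>x\<^sub>1\<^sup>2 + \<dots> + x\<^sub>n\<^sup>2 = t\<close>. Fixing the last
  two entries gives \<open>N\<^bsub>n+2\<^esub>(t) = \<Sum>\<^bsub>u,v\<^esub> N\<^sub>n(t - uv)\<close>. For each of the \<open>q - 1\<close> elements
  \<open>u \<noteq> 0\<close> the product \<open>uv\<close> runs through the whole field as \<open>v\<close> does, and these \<open>v\<close> account for
  every \<open>n\<close>-tuple once, contributing \<open>q\<^sup>n\<close>; for \<open>u = 0\<close> the contribution is \<open>q N\<^sub>n(t)\<close>. Hence
  \<open>N\<^bsub>n+2\<^esub>(t) = (q - 1) q\<^sup>n + q N\<^sub>n(t)\<close>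
  (lemma \<open>card_square_sum_tuples_add2\<close>), and the formula follows by induction from \<open>N\<^sub>0\<close>,
  which is \<open>1\<close> at \<open>0\<close> and \<open>0\<close> elsewhere. For \<open>\<int>\<^sub>p\<close>, the element \<open>w\<close> exists because
  \<open>p \<equiv> 1 (mod 4)\<close>, by Euler's criterion.
\<close>

section \<open>Sums of squares over a commutative ring\<close>

definition square_sum_tuples :: "('a, 'b) ring_scheme \<Rightarrow> nat \<Rightarrow> 'a \<Rightarrow> (nat \<Rightarrow> 'a) set" where
  "square_sum_tuples R n t =
     {x \<in> {1..n} \<rightarrow>\<^sub>E carrier R. (\<Oplus>\<^bsub>R\<^esub>i\<in>{1..n}. x i [^]\<^bsub>R\<^esub> (2::nat)) = t}"

lemma finite_square_sum_tuples:
  "finite (carrier R) \<Longrightarrow> finite (square_sum_tuples R n t)"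
  unfolding square_sum_tuples_def by (simp add: finite_PiE)

context cring
begin

lemma card_square_sum_tuples_0:
  "card (square_sum_tuples R 0 t) = (if t = \<zero> then 1 else 0)"
  unfolding square_sum_tuples_def by auto

text \<open>Every tuple in \<open>R\<^sup>n\<close> solves the equation for exactly one right-hand side.\<close>
lemma sum_card_square_sum_tuples:
  assumes "finite (carrier R)"
  shows "(\<Sum>t\<in>carrier R. card (square_sum_tuples R n t)) = card (carrier R) ^ n"
proof -
  have "(\<Union>t\<in>carrier R. square_sum_tuples R n t) = {1..n} \<rightarrow>\<^sub>E carrier R"
    unfolding square_sum_tuples_def
    by (auto intro!: finsum_closed simp: PiE_iff extensional_def)
  moreover have "card (\<Union>t\<in>carrier R. square_sum_tuples R n t) =
      (\<Sum>t\<in>carrier R. card (square_sum_tuples R n t))"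
    using assms by (intro card_UN_disjoint)
      (simp_all add: finite_square_sum_tuples, auto simp: square_sum_tuples_def)
  ultimately show ?thesis
    by (simp add: card_funcsetE)
qed

lemma sum_card_square_sum_tuples_diff:
  assumes "finite (carrier R)" "t \<in> carrier R"
  shows "(\<Sum>s\<in>carrier R. card (square_sum_tuples R n (t \<ominus> s))) = card (carrier R) ^ n"
proof -
  have inv: "t \<ominus> (t \<ominus> s) = s" if "s \<in> carrier R" for s
    using assms(2) that by algebra
  have "bij_betw (\<lambda>s. t \<ominus> s) (carrier R) (carrier R)"
    using assms(2) inv by (intro bij_betw_byWitness[where f' = "\<lambda>s. t \<ominus> s"]) auto
  from sum.reindex_bij_betw[OF this, of "\<lambda>s. card (square_sum_tuples R n s)"] show ?thesis
    using sum_card_square_sum_tuples[OF assms(1)] by simp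
qed

text \<open>
  A solution in \<open>n + 1\<close> unknowns is a free choice of the last entry \<open>a\<close> together with a solution
  in \<open>n\<close> unknowns for the right-hand side \<open>t - a\<^sup>2\<close>.
\<close>
lemma square_sum_tuples_Suc:
  assumes "t \<in> carrier R"
  shows "square_sum_tuples R (Suc n) t =
    (\<lambda>(a, x). x(Suc n := a)) ` (SIGMA a:carrier R. square_sum_tuples R n (t \<ominus> a [^] (2::nat)))"
proof -
  have ins: "{1..Suc n} = insert (Suc n) {1..n}" by auto
  have split: "(\<Oplus>i\<in>{1..Suc n}. (x(Suc n := a)) i [^] (2::nat)) = t \<longleftrightarrow>
      (\<Oplus>i\<in>{1..n}. x i [^] (2::nat)) = t \<ominus> a [^] (2::nat)"
    if a: "a \<in> carrier R" and x: "x \<in> {1..n} \<rightarrow>\<^sub>E carrier R" for a x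
  proof -
    have cl: "(\<Oplus>i\<in>{1..n}. x i [^] (2::nat)) \<in> carrier R"
      using x by (auto intro!: finsum_closed simp: PiE_iff)
    have "(\<Oplus>i\<in>{1..Suc n}. (x(Suc n := a)) i [^] (2::nat)) =
        a [^] (2::nat) \<oplus> (\<Oplus>i\<in>{1..n}. (x(Suc n := a)) i [^] (2::nat))"
      unfolding ins using a x by (subst finsum_insert) (auto simp: PiE_iff)
    also have "(\<Oplus>i\<in>{1..n}. (x(Suc n := a)) i [^] (2::nat)) = (\<Oplus>i\<in>{1..n}. x i [^] (2::nat))"
      using x by (intro finsum_cong') (auto simp: PiE_iff)
    finally have "(\<Oplus>i\<in>{1..Suc n}. (x(Suc n := a)) i [^] (2::nat)) =
        a [^] (2::nat) \<oplus> (\<Oplus>i\<in>{1..n}. x i [^] (2::nat))" .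
    moreover have "c \<oplus> s = t \<longleftrightarrow> s = t \<ominus> c" if "c \<in> carrier R" "s \<in> carrier R" for c s
    proof -
      have "s = (c \<oplus> s) \<ominus> c" "c \<oplus> (t \<ominus> c) = t"
        using that assms by algebra+
      then show ?thesis
        by auto
    qed
    ultimately show ?thesis
      using cl a by simp
  qed
  show ?thesis
  proof (intro equalityI subsetI)
    fix y assume y: "y \<in> square_sum_tuples R (Suc n) t"
    then obtain a x where ax: "a \<in> carrier R" "x \<in> {1..n} \<rightarrow>\<^sub>E carrier R" "y = x(Suc n := a)"
      unfolding square_sum_tuples_def ins PiE_insert_eq by auto
    then show "y \<in> (\<lambda>(a, x). x(Suc n := a)) `
        (SIGMA a:carrier R. square_sum_tuples R n (t \<ominus> a [^] (2::nat)))"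
      using y split[OF ax(1,2)] unfolding square_sum_tuples_def by auto
  next
    fix y assume "y \<in> (\<lambda>(a, x). x(Suc n := a)) `
        (SIGMA a:carrier R. square_sum_tuples R n (t \<ominus> a [^] (2::nat)))"
    then obtain a x where ax: "a \<in> carrier R" "x \<in> {1..n} \<rightarrow>\<^sub>E carrier R" "y = x(Suc n := a)"
      "(\<Oplus>i\<in>{1..n}. x i [^] (2::nat)) = t \<ominus> a [^] (2::nat)"
      unfolding square_sum_tuples_def by auto
    moreover have "y \<in> {1..Suc n} \<rightarrow>\<^sub>E carrier R"
      unfolding ins PiE_insert_eq using ax by auto
    ultimately show "y \<in> square_sum_tuples R (Suc n) t"
      using split[OF ax(1,2)] unfolding square_sum_tuples_def by blast
  qed
qed

lemma card_square_sum_tuples_Suc: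
  assumes "finite (carrier R)" "t \<in> carrier R"
  shows "card (square_sum_tuples R (Suc n) t) =
    (\<Sum>a\<in>carrier R. card (square_sum_tuples R n (t \<ominus> a [^] (2::nat))))"
proof -
  have "inj_on (\<lambda>(a, x). x(Suc n := a))
      (SIGMA a:carrier R. square_sum_tuples R n (t \<ominus> a [^] (2::nat)))"
    by (rule inj_on_subset[OF inj_combinator[of "Suc n" "{1..n}" "\<lambda>_. carrier R"]])
      (auto simp: square_sum_tuples_def)
  then show ?thesis
    using assms by (simp add: square_sum_tuples_Suc card_image card_SigmaI finite_square_sum_tuples)
qed

end

section \<open>Finite fields containing a square root of minus one\<close>

context field
begin

text \<open>
  If \<open>w\<^sup>2 = -1\<close> and \<open>2 \<noteq> 0\<close>, the form \<open>a\<^sup>2 + b\<^sup>2\<close> is hyperbolic: the linear substitution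
  \<open>u = a + wb\<close>, \<open>v = a - wb\<close> of determinant \<open>-2w \<noteq> 0\<close> turns it into \<open>uv\<close>.
\<close>
lemma sum_over_sum_of_two_squares:
  fixes f :: "'a \<Rightarrow> nat"
  assumes fin: "finite (carrier R)" and two: "\<one> \<oplus> \<one> \<noteq> \<zero>"
    and w: "w \<in> carrier R" "w \<otimes> w = \<ominus> \<one>"
  shows "(\<Sum>a\<in>carrier R. \<Sum>b\<in>carrier R. f (a [^] (2::nat) \<oplus> b [^] (2::nat))) =
    (\<Sum>u\<in>carrier R. \<Sum>v\<in>carrier R. f (u \<otimes> v))"
proof -
  define h where "h = (\<lambda>(a, b). (a \<oplus> w \<otimes> b, a \<ominus> w \<otimes> b))"
  have w0: "w \<noteq> \<zero>"
  proof
    assume "w = \<zero>"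
    then have "\<ominus> \<one> = \<zero>"
      using w by simp
    then show False
      by (metis add.inv_eq_1_iff one_closed one_not_zero)
  qed
  \<comment> \<open>\<open>h (a, b)\<close> determines \<open>2a\<close> as the sum of its components; hence \<open>2\<close> must be cancelled.\<close>
  have cancel_two: "x = y" if "x \<oplus> x = y \<oplus> y" "x \<in> carrier R" "y \<in> carrier R" for x y
  proof -
    have "(\<one> \<oplus> \<one>) \<otimes> x = (\<one> \<oplus> \<one>) \<otimes> y"
      using that by (simp add: l_distr)
    then show ?thesis
      using that two by (simp add: m_lcancel)
  qed
  have inj: "inj_on h (carrier R \<times> carrier R)"
  proof (rule inj_onI, clarify)
    fix a b c d
    assume cl: "a \<in> carrier R" "b \<in> carrier R" "c \<in> carrier R" "d \<in> carrier R"
      and "h (a, b) = h (c, d)"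
    then have e: "a \<oplus> w \<otimes> b = c \<oplus> w \<otimes> d" "a \<ominus> w \<otimes> b = c \<ominus> w \<otimes> d"
      by (auto simp: h_def)
    have "a \<oplus> a = (a \<oplus> w \<otimes> b) \<oplus> (a \<ominus> w \<otimes> b)"
      using cl w(1) by algebra
    also have "\<dots> = (c \<oplus> w \<otimes> d) \<oplus> (c \<ominus> w \<otimes> d)"
      by (simp only: e)
    also have "\<dots> = c \<oplus> c"
      using cl w(1) by algebra
    finally have ac: "a = c"
      using cancel_two cl by blast
    then have "w \<otimes> b = w \<otimes> d"
      using e(1) cl w(1) by simp
    then show "a = c \<and> b = d"
      using ac w0 w(1) cl by (simp add: m_lcancel)
  qed
  have "h ` (carrier R \<times> carrier R) \<subseteq> carrier R \<times> carrier R"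
    using w(1) by (auto simp: h_def)
  then have "bij_betw h (carrier R \<times> carrier R) (carrier R \<times> carrier R)"
    using inj fin by (simp add: bij_betw_def endo_inj_surj)
  note reindex = sum.reindex_bij_betw[OF this, of "\<lambda>(u, v). f (u \<otimes> v)"]
  have "(a \<oplus> w \<otimes> b) \<otimes> (a \<ominus> w \<otimes> b) = a [^] (2::nat) \<oplus> b [^] (2::nat)"
    if "a \<in> carrier R" "b \<in> carrier R" for a b
  proof -
    have "(a \<oplus> w \<otimes> b) \<otimes> (a \<ominus> w \<otimes> b) = a \<otimes> a \<ominus> (w \<otimes> w) \<otimes> (b \<otimes> b)"
      using that w(1) by algebra
    also have "\<dots> = a \<otimes> a \<oplus> b \<otimes> b"
      unfolding w(2) using that by algebra
    finally show ?thesis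
      using that by (simp add: numeral_2_eq_2)
  qed
  then have "(\<Sum>p\<in>carrier R \<times> carrier R. (\<lambda>(u, v). f (u \<otimes> v)) (h p)) =
      (\<Sum>(a, b)\<in>carrier R \<times> carrier R. f (a [^] (2::nat) \<oplus> b [^] (2::nat)))"
    by (intro sum.cong) (auto simp: h_def)
  with reindex show ?thesis
    by (simp add: sum.cartesian_product)
qed

text \<open>
  For \<open>u \<noteq> 0\<close>, multiplication by \<open>u\<close> permutes the field; for \<open>u = 0\<close> every product is \<open>0\<close>.
\<close>
lemma sum_over_products:
  fixes f :: "'a \<Rightarrow> nat"
  assumes fin: "finite (carrier R)"
  shows "(\<Sum>u\<in>carrier R. \<Sum>v\<in>carrier R. f (u \<otimes> v)) =
    (card (carrier R) - 1) * (\<Sum>v\<in>carrier R. f v) + card (carrier R) * f \<zero>"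
proof -
  have "(\<Sum>v\<in>carrier R. f (u \<otimes> v)) = (\<Sum>v\<in>carrier R. f v)"
    if u: "u \<in> carrier R - {\<zero>}" for u
  proof -
    have "inj_on ((\<otimes>) u) (carrier R)"
      using u by (auto simp: inj_on_def m_lcancel)
    moreover have "(\<otimes>) u ` carrier R \<subseteq> carrier R"
      using u by auto
    ultimately have "bij_betw ((\<otimes>) u) (carrier R) (carrier R)"
      using fin by (simp add: bij_betw_def endo_inj_surj)
    then show ?thesis
      by (rule sum.reindex_bij_betw)
  qed
  then have "(\<Sum>u\<in>carrier R - {\<zero>}. \<Sum>v\<in>carrier R. f (u \<otimes> v)) =
      (card (carrier R) - 1) * (\<Sum>v\<in>carrier R. f v)"
    using fin by (simp add: card_Diff_singleton)
  moreover have "(\<Sum>v\<in>carrier R. f (\<zero> \<otimes> v)) = card (carrier R) * f \<zero>"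
    by simp
  ultimately show ?thesis
    by (subst sum.remove[OF fin zero_closed]) simp
qed

text \<open>
  The two squares split off are traded for a product \<open>uv\<close>. The terms with \<open>u \<noteq> 0\<close> then
  contribute the same for every \<open>t\<close>; only those with \<open>u = 0\<close> remember \<open>t\<close>.
\<close>
lemma card_square_sum_tuples_add2:
  assumes fin: "finite (carrier R)" and two: "\<one> \<oplus> \<one> \<noteq> \<zero>"
    and w: "w \<in> carrier R" "w \<otimes> w = \<ominus> \<one>" and t: "t \<in> carrier R"
  shows "card (square_sum_tuples R (Suc (Suc n)) t) =
    (card (carrier R) - 1) * card (carrier R) ^ n +
    card (carrier R) * card (square_sum_tuples R n t)"
proof -
  let ?f = "\<lambda>s. card (square_sum_tuples R n (t \<ominus> s))"
  have "(t \<ominus> a [^] (2::nat)) \<ominus> b [^] (2::nat) = t \<ominus> (a [^] (2::nat) \<oplus> b [^] (2::nat))"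
    if "a \<in> carrier R" "b \<in> carrier R" for a b
    using t nat_pow_closed[OF that(1), of 2] nat_pow_closed[OF that(2), of 2] by algebra
  then have "card (square_sum_tuples R (Suc (Suc n)) t) =
      (\<Sum>a\<in>carrier R. \<Sum>b\<in>carrier R. ?f (a [^] (2::nat) \<oplus> b [^] (2::nat)))"
    using fin t by (simp add: card_square_sum_tuples_Suc)
  also have "\<dots> = (\<Sum>u\<in>carrier R. \<Sum>v\<in>carrier R. ?f (u \<otimes> v))"
    by (rule sum_over_sum_of_two_squares[OF fin two w])
  also have "\<dots> = (card (carrier R) - 1) * (\<Sum>v\<in>carrier R. ?f v) + card (carrier R) * ?f \<zero>"
    by (rule sum_over_products[OF fin])
  also have "(\<Sum>v\<in>carrier R. ?f v) = card (carrier R) ^ n"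
    by (rule sum_card_square_sum_tuples_diff[OF fin t])
  also have "t \<ominus> \<zero> = t"
    using t by algebra
  finally show ?thesis .
qed

text \<open>
  The closed form solves the recurrence of the previous lemma. Multiplying it by \<open>q\<close> avoids
  the negative exponents that \<open>q\<^bsup>2m-1\<^esup> - q\<^bsup>m-1\<^esup>\<close> would have at \<open>m = 0\<close>, so that the
  induction can start from the empty tuple.
\<close>
lemma card_square_sum_tuples_even:
  assumes fin: "finite (carrier R)" and two: "\<one> \<oplus> \<one> \<noteq> \<zero>"
    and w: "w \<in> carrier R" "w \<otimes> w = \<ominus> \<one>" and t: "t \<in> carrier R"
  defines "q \<equiv> int (card (carrier R))"
  shows "q * int (card (square_sum_tuples R (2 * m) t)) =
    q ^ (2 * m) - q ^ m + (if t = \<zero> then q ^ Suc m else 0)"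
proof (induction m)
  case 0
  show ?case
    by (simp add: card_square_sum_tuples_0)
next
  case (Suc m)
  have "card (carrier R) \<ge> 1"
    using fin zero_closed by (metis One_nat_def Suc_leI card_gt_0_iff empty_iff)
  then have "int (card (square_sum_tuples R (2 * Suc m) t)) =
      (q - 1) * q ^ (2 * m) + q * int (card (square_sum_tuples R (2 * m) t))"
    using card_square_sum_tuples_add2[OF fin two w t, of "2 * m"] by (simp add: q_def of_nat_diff)
  also have "\<dots> = (q - 1) * q ^ (2 * m) + (q ^ (2 * m) - q ^ m + (if t = \<zero> then q ^ Suc m else 0))"
    by (simp only: Suc.IH)
  finally have count: "int (card (square_sum_tuples R (2 * Suc m) t)) = \<dots>" .
  show ?case
    unfolding count by (simp add: algebra_simps)
qed

end

section \<open>Prime fields\<close>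

text \<open>
  Since \<open>4\<close> divides \<open>p - 1\<close>, the exponent \<open>(p - 1) div 2\<close> in Euler's criterion is even, so the
  Legendre symbol of \<open>-1\<close> is \<open>1\<close>.
\<close>
lemma minus_one_quadratic_residue:
  fixes p :: nat
  assumes "prime p" "[p = 1] (mod 4)"
  shows "QuadRes (int p) (- 1)"
proof -
  have p1: "p > 1"
    using assms(1) by (rule prime_gt_1_nat)
  then have p2: "p > 2"
    using assms(2) by (cases "p = 2") (auto simp: cong_def)
  have "4 dvd p - 1"
    using assms(2) p1 by (simp add: cong_altdef_nat)
  then have "even ((p - 1) div 2)"
    by auto
  then have "[Legendre (- 1) (int p) = 1] (mod int p)"
    using euler_criterion[OF assms(1) p2, of "- 1"] by simp
  moreover have "\<not> [(- 1 :: int) = 1] (mod int p)"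
  proof
    assume "[(- 1 :: int) = 1] (mod int p)"
    then have "int p dvd 2"
      by (simp add: cong_iff_dvd_diff)
    then show False
      using p2 zdvd_imp_le[of "int p" 2] by simp
  qed
  moreover have "\<not> [(0 :: int) = 1] (mod int p)"
    using p1 by (simp add: cong_iff_dvd_diff)
  ultimately show ?thesis
    by (auto simp: Legendre_def split: if_splits)
qed

theorem theorem1p6:
  fixes p m :: nat and t :: int
  assumes "prime p" and "odd p" and "[p = 1] (mod 4)"
    and "m \<ge> 1"
    and "t \<in> carrier (residue_ring (int p))"
  shows "int (sum_squares_count (2 * m) t p) =
    (if t = \<zero>\<^bsub>residue_ring (int p)\<^esub>
     then int p ^ (2 * m - 1) + int p ^ m - int p ^ (m - 1)
     else int p ^ (2 * m - 1) - int p ^ (m - 1))"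
proof -
  define F where "F = residue_ring (int p)"
  interpret residues_prime p F
    using assms(1) by unfold_locales (simp_all add: F_def)
  have p2: "int p > 2"
    using prime_gt_1_nat[OF assms(1)] assms(2) by (cases "p = 2") auto
  have fin: "finite (carrier F)" and card: "card (carrier F) = p"
    by (simp_all add: res_carrier_eq)
  have two: "\<one>\<^bsub>F\<^esub> \<oplus>\<^bsub>F\<^esub> \<one>\<^bsub>F\<^esub> \<noteq> \<zero>\<^bsub>F\<^esub>"
    using p2 by (simp add: res_one_eq res_add_eq res_zero_eq)
  obtain y where y: "[y ^ 2 = - 1] (mod int p)"
    using minus_one_quadratic_residue[OF assms(1,3)] by (auto simp: QuadRes_def)
  define w where "w = y mod int p"
  have w: "w \<in> carrier F" "w \<otimes>\<^bsub>F\<^esub> w = \<ominus>\<^bsub>F\<^esub> \<one>\<^bsub>F\<^esub>"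
    using y p2 by (simp_all add: w_def res_carrier_eq res_mult_eq res_neg_eq res_one_eq
        cong_def power2_eq_square mod_mult_eq)
  obtain k where k: "m = Suc k"
    using assms(4) by (cases m) auto
  have count: "sum_squares_count (2 * m) t p = card (square_sum_tuples F (2 * m) t)"
    by (simp add: sum_squares_count_def square_sum_tuples_def F_def)
  have "int p * int (sum_squares_count (2 * m) t p) =
      int p ^ (2 * m) - int p ^ m + (if t = \<zero>\<^bsub>F\<^esub> then int p ^ Suc m else 0)"
    using card_square_sum_tuples_even[OF fin two w, of t m] assms(5)
    by (simp only: card count flip: F_def)
  also have "\<dots> = int p * (int p ^ (2 * m - 1) - int p ^ (m - 1) +
      (if t = \<zero>\<^bsub>F\<^esub> then int p ^ m else 0))"
    by (simp add: k algebra_simps)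
  finally have "int (sum_squares_count (2 * m) t p) =
      int p ^ (2 * m - 1) - int p ^ (m - 1) + (if t = \<zero>\<^bsub>F\<^esub> then int p ^ m else 0)"
    using p2 by simp
  then show ?thesis
    by (simp add: F_def)
qed

end
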